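(* Let $n\ge 1$ and let $L_n$ denote the total number of chains in the chain decompositions of all elements of $\mathcal{IS}_n$. Then $$L_n=\sum_{\alpha\in\mathcal{IS}_n}\operatorname{st.rank}(\alpha).$$
   Context: Let $N=\{1,2,\dots,n\}$. $\mathcal{IS}_n$ is the symmetric inverse semigroup, i.e. the set of all partial injective maps $\alpha$ from $N$ to $N$ (bijections from a subset $\operatorname{dom}(\alpha)\subseteq N$ onto a subset $\operatorname{im}(\alpha)\subseteq N$; the empty map is allowed), under composition of partial maps. The graph of the action of $\alpha$ is the directed graph on $N$ with an arrow $x\to\alpha(x)$ for each $x\in\operatorname{dom}(\alpha)$. Each connected component is either a directed cycle (a "cycle" of $\alpha$; a fixed point is a cycle of length 1) or a directed path $a_1\to a_2\to\dots\to a_k$, $k\ge1$, with $a_1\notin\operatorname{im}(\alpha)$ and $a_k\notin\operatorname{dom}(\alpha)$ (a "chain" of $\alpha$, written $[a_1,\dots,a_k]$; a chain of length 1 is a point $x\notin\operatorname{dom}(\alpha)\cup\operatorname{im}(\alpha)$). This is the chain decomposition of $\alpha$. The permutational part of $\alpha$ is the restriction of $\alpha$ to the set of points lying on cycles of $\alpha$; the stable rank $\operatorname{st.rank}(\alpha)$ is the rank of the permutational part, i.e. the number of points of $N$ lying on cycles of $\alpha$. *)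

theory Defs
  imports Main
begin

text \<open>
  A partial map on \<open>{1..n}\<close> is a \<open>nat \<rightharpoonup> nat\<close> that is undefined outside \<open>{1..n}\<close>, so that
  distinct elements of \<open>IS n\<close> are distinct partial maps on \<open>{1..n}\<close>.
\<close>
definition IS :: "nat \<Rightarrow> (nat \<rightharpoonup> nat) set" where
  "IS n = {\<alpha>. dom \<alpha> \<subseteq> {1..n} \<and> ran \<alpha> \<subseteq> {1..n} \<and> inj_on \<alpha> (dom \<alpha>)}"

definition arrows :: "(nat \<rightharpoonup> nat) \<Rightarrow> (nat \<times> nat) set" where
  "arrows \<alpha> = {(x, y). \<alpha> x = Some y}"

text \<open>Connectedness ignores the direction of the arrows.\<close>
definition components :: "nat \<Rightarrow> (nat \<rightharpoonup> nat) \<Rightarrow> nat set set" where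
  "components n \<alpha> = {1..n} // {(x, y) \<in> {1..n} \<times> {1..n}. (x, y) \<in> (arrows \<alpha> \<union> (arrows \<alpha>)\<inverse>)\<^sup>*}"

text \<open>
  A cycle is represented by its set of points, since its listing is only determined up to
  rotation. A chain \<open>[a\<^sub>1, \<dots>, a\<^sub>k]\<close> is represented by the list itself.
\<close>
definition cycles :: "nat \<Rightarrow> (nat \<rightharpoonup> nat) \<Rightarrow> nat set set" where
  "cycles n \<alpha> = {C \<in> components n \<alpha>. \<exists>as. as \<noteq> [] \<and> distinct as \<and> set as = C \<and>
     (\<forall>i < length as. (as ! i, as ! (Suc i mod length as)) \<in> arrows \<alpha>)}"

definition chains :: "nat \<Rightarrow> (nat \<rightharpoonup> nat) \<Rightarrow> nat list set" where
  "chains n \<alpha> = {as. as \<noteq> [] \<and> distinct as \<and> set as \<in> components n \<alpha> \<and>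
     (\<forall>i. Suc i < length as \<longrightarrow> (as ! i, as ! Suc i) \<in> arrows \<alpha>) \<and>
     hd as \<notin> ran \<alpha> \<and> last as \<notin> dom \<alpha>}"

definition permutational_part :: "nat \<Rightarrow> (nat \<rightharpoonup> nat) \<Rightarrow> (nat \<rightharpoonup> nat)" where
  "permutational_part n \<alpha> = \<alpha> |` \<Union> (cycles n \<alpha>)"

definition rank :: "(nat \<rightharpoonup> nat) \<Rightarrow> nat" where
  "rank \<alpha> = card (ran \<alpha>)"

definition stable_rank :: "nat \<Rightarrow> (nat \<rightharpoonup> nat) \<Rightarrow> nat" where
  "stable_rank n \<alpha> = rank (permutational_part n \<alpha>)"

definition total_chains :: "nat \<Rightarrow> nat" where
  "total_chains n = (\<Sum>\<alpha>\<in>IS n. card (chains n \<alpha>))"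

text \<open>Finiteness ensures that the sums and cardinalities above are not degenerate.\<close>

lemma finite_IS: "finite (IS n)"
proof -
  have "IS n \<subseteq> (\<Union>A \<in> Pow {1..n}. {\<alpha>. dom \<alpha> = A \<and> ran \<alpha> \<subseteq> {1..n}})"
    unfolding IS_def by blast
  moreover have "finite (\<Union>A \<in> Pow {1..n}. {\<alpha>::nat \<rightharpoonup> nat. dom \<alpha> = A \<and> ran \<alpha> \<subseteq> {1..n}})"
    by (auto intro!: finite_set_of_finite_maps intro: finite_subset[OF _ finite_atLeastAtMost])
  ultimately show ?thesis by (rule finite_subset)
qed

lemma finite_chains: "finite (chains n \<alpha>)"
proof -
  have "set as \<subseteq> {1..n} \<and> length as \<le> n" if "as \<in> chains n \<alpha>" for as
  proof -
    from that have d: "distinct as" and s: "set as \<subseteq> {1..n}"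
      unfolding chains_def components_def quotient_def by auto
    from s have "card (set as) \<le> card {1..n}" by (intro card_mono) auto
    with d s show ?thesis by (simp add: distinct_card)
  qed
  then show ?thesis
    by (intro finite_subset[OF _ finite_lists_length_le[of "{1..n}" n]]) auto
qed

lemma finite_ran_permutational_part: "\<alpha> \<in> IS n \<Longrightarrow> finite (ran (permutational_part n \<alpha>))"
  by (rule finite_subset[of _ "{1..n}"])
    (auto simp: IS_def permutational_part_def ran_def restrict_map_def split: if_splits)

end

theory Submission
  imports Defs
begin

text \<open>
  The theorem comes from closing chains into cycles. Given \<open>\<alpha>\<close> and one of its chains
  \<open>[a\<^sub>1, \<dots>, a\<^sub>k]\<close>, add the arrow \<open>a\<^sub>k \<rightarrow> a\<^sub>1\<close>: the result is again a partial injection, and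
  \<open>[a\<^sub>1, \<dots>, a\<^sub>k]\<close> now lists one of its cycles, with a distinguished starting point. Conversely,
  deleting the arrow that returns to the distinguished point of a cycle leaves a chain. These
  operations are mutually inverse, so pairs (partial injection, chain) are equinumerous
  with pairs (partial injection, cycle listed from some starting point); this is
  \<open>bij_betw_close_chain\<close>.

  A cycle listing is determined by its first point, which may be any point on a cycle
  (\<open>bij_betw_hd_cycle_listings\<close>). Hence a partial injection has as many cycle listings as
  points on cycles, and that number is its stable rank.

  Both operations must produce whole components of the new graph. This holds because, by
  injectivity, neither a chain nor a cycle can be left along an arrow in either direction
  (\<open>path_closed_if_ends_closed\<close>), so its points form a component
  (\<open>path_closed_in_components\<close>).
\<close>

section \<open>Chains and cycles as lists\<close>

text \<open>
  Unlike the sets in \<^const>\<open>cycles\<close>, these lists remember a starting point, and membership in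
  \<^const>\<open>components\<close> is reduced to a condition on the points.
\<close>
definition cycle_listings :: "nat \<Rightarrow> (nat \<rightharpoonup> nat) \<Rightarrow> nat list set" where
  "cycle_listings n \<alpha> = {as. as \<noteq> [] \<and> distinct as \<and> set as \<subseteq> {1..n} \<and>
     (\<forall>i < length as. \<alpha> (as ! i) = Some (as ! (Suc i mod length as)))}"

text \<open>
  Splits off the closing arrow: a cycle listing and a chain with the same points have all other
  arrows in common.
\<close>
lemma cyclic_arrows_iff:
  assumes "as \<noteq> []"
  shows "(\<forall>i < length as. \<alpha> (as ! i) = Some (as ! (Suc i mod length as))) \<longleftrightarrow>
    (\<forall>i. Suc i < length as \<longrightarrow> \<alpha> (as ! i) = Some (as ! Suc i)) \<and> \<alpha> (last as) = Some (hd as)"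
    (is "?L \<longleftrightarrow> ?R")
proof
  assume L: ?L
  have "length as - 1 < length as" "Suc (length as - 1) = length as" using assms by auto
  with L have "\<alpha> (as ! (length as - 1)) = Some (as ! 0)" by (metis mod_self)
  moreover have "\<alpha> (as ! i) = Some (as ! Suc i)" if "Suc i < length as" for i
    using L that by (metis Suc_lessD mod_less)
  ultimately show ?R using assms by (simp add: last_conv_nth hd_conv_nth)
next
  assume R: ?R
  show ?L
  proof (intro allI impI)
    fix i assume i: "i < length as"
    show "\<alpha> (as ! i) = Some (as ! (Suc i mod length as))"
    proof (cases "Suc i < length as")
      case True
      then show ?thesis using R by simp
    next
      case False
      with i have "Suc i = length as" "i = length as - 1" by auto
      then show ?thesis using R assms by (simp add: last_conv_nth hd_conv_nth)
    qed
  qed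
qed

lemma cycle_listings_iff:
  "as \<in> cycle_listings n \<alpha> \<longleftrightarrow> as \<noteq> [] \<and> distinct as \<and> set as \<subseteq> {1..n} \<and>
     (\<forall>i. Suc i < length as \<longrightarrow> \<alpha> (as ! i) = Some (as ! Suc i)) \<and> \<alpha> (last as) = Some (hd as)"
  unfolding cycle_listings_def using cyclic_arrows_iff by blast

text \<open>
  The path connects its points to one another, and closure under arrows in both directions
  prevents their connected component from containing anything else.
\<close>
lemma path_closed_in_components:
  assumes "as \<noteq> []" and sub: "set as \<subseteq> {1..n}"
    and path: "\<And>i. Suc i < length as \<Longrightarrow> \<alpha> (as ! i) = Some (as ! Suc i)"
    and closed: "\<And>x y. \<alpha> x = Some y \<Longrightarrow> x \<in> set as \<longleftrightarrow> y \<in> set as"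
  shows "set as \<in> components n \<alpha>"
proof -
  define R where "R = (arrows \<alpha> \<union> (arrows \<alpha>)\<inverse>)\<^sup>*"
  have from_start: "(as ! 0, as ! i) \<in> R" if "i < length as" for i
    using that
  proof (induction i)
    case 0
    then show ?case by (simp add: R_def)
  next
    case (Suc i)
    then have "(as ! 0, as ! i) \<in> R" by simp
    moreover have "(as ! i, as ! Suc i) \<in> arrows \<alpha>" using path Suc.prems by (simp add: arrows_def)
    ultimately show ?case unfolding R_def by (meson UnI1 rtrancl.rtrancl_into_rtrancl)
  qed
  have stays: "y \<in> set as" if "(as ! 0, y) \<in> R" for y
    using that unfolding R_def
  proof (induction rule: rtrancl_induct)
    case base
    then show ?case using assms(1) by simp
  next
    case (step y z)
    then show ?case using closed by (auto simp: arrows_def)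
  qed
  have "as ! 0 \<in> {1..n}" using sub assms(1) by (meson length_greater_0_conv nth_mem subsetD)
  moreover have "set as = {(x, y) \<in> {1..n} \<times> {1..n}. (x, y) \<in> R} `` {as ! 0}"
    using from_start stays sub calculation by (auto simp: in_set_conv_nth)
  ultimately show ?thesis unfolding components_def R_def[symmetric]
    by (metis (no_types, lifting) quotientI)
qed

lemma components_subset: "C \<in> components n \<alpha> \<Longrightarrow> C \<subseteq> {1..n}"
  by (auto simp: components_def quotient_def)

lemma IS_injD: "\<alpha> \<in> IS n \<Longrightarrow> \<alpha> x = Some z \<Longrightarrow> \<alpha> y = Some z \<Longrightarrow> x = y"
  unfolding IS_def inj_on_def dom_def by force

text \<open>
  An arrow leaving a point of the path is the next arrow of the path, unless the point is the last
  one; an arrow entering a point is the previous arrow of the path, by injectivity, unless the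
  point is the first one. Hence only the two ends have to be examined.
\<close>
lemma path_closed_if_ends_closed:
  assumes \<alpha>: "\<alpha> \<in> IS n"
    and path: "\<And>i. Suc i < length as \<Longrightarrow> \<alpha> (as ! i) = Some (as ! Suc i)"
    and last: "\<And>y. \<alpha> (last as) = Some y \<Longrightarrow> y \<in> set as"
    and hd: "\<And>x. \<alpha> x = Some (hd as) \<Longrightarrow> x \<in> set as"
    and xy: "\<alpha> x = Some y"
  shows "x \<in> set as \<longleftrightarrow> y \<in> set as"
proof
  assume "x \<in> set as"
  then obtain i where i: "i < length as" "x = as ! i" by (auto simp: in_set_conv_nth)
  show "y \<in> set as"
  proof (cases "Suc i < length as")
    case True
    then show ?thesis using path[OF True] xy i by auto
  next
    case False
    then have "i = length as - 1" "as \<noteq> []" using i by auto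
    then have "x = last as" using i by (simp add: last_conv_nth)
    then show ?thesis using last xy by blast
  qed
next
  assume "y \<in> set as"
  then obtain i where i: "i < length as" "y = as ! i" by (auto simp: in_set_conv_nth)
  show "x \<in> set as"
  proof (cases i)
    case 0
    then have "y = hd as" using i by (metis hd_conv_nth length_greater_0_conv)
    then show ?thesis using hd xy by blast
  next
    case (Suc j)
    then have "x = as ! j" using IS_injD[OF \<alpha> xy] path i by blast
    then show ?thesis using Suc i by simp
  qed
qed

lemma chains_iff:
  assumes \<alpha>: "\<alpha> \<in> IS n"
  shows "as \<in> chains n \<alpha> \<longleftrightarrow> as \<noteq> [] \<and> distinct as \<and> set as \<subseteq> {1..n} \<and>
     (\<forall>i. Suc i < length as \<longrightarrow> \<alpha> (as ! i) = Some (as ! Suc i)) \<and>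
     hd as \<notin> ran \<alpha> \<and> \<alpha> (last as) = None" (is "_ \<longleftrightarrow> ?R")
proof
  assume "as \<in> chains n \<alpha>"
  then show ?R
    unfolding chains_def arrows_def using components_subset[of "set as" n \<alpha>] by (simp add: domIff)
next
  assume R: ?R
  have "set as \<in> components n \<alpha>"
  proof (rule path_closed_in_components)
    show "x \<in> set as \<longleftrightarrow> y \<in> set as" if "\<alpha> x = Some y" for x y
      by (rule path_closed_if_ends_closed[OF \<alpha> _ _ _ that]) (use R in \<open>auto simp: ran_def\<close>)
  qed (use R in auto)
  then show "as \<in> chains n \<alpha>" using R by (auto simp: chains_def arrows_def)
qed

lemma cycles_eq_image_cycle_listings:
  assumes \<alpha>: "\<alpha> \<in> IS n"
  shows "cycles n \<alpha> = set ` cycle_listings n \<alpha>"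
proof
  show "cycles n \<alpha> \<subseteq> set ` cycle_listings n \<alpha>"
  proof
    fix C assume "C \<in> cycles n \<alpha>"
    then obtain as where "C \<in> components n \<alpha>" "as \<noteq> []" "distinct as" "set as = C"
      "\<forall>i < length as. \<alpha> (as ! i) = Some (as ! (Suc i mod length as))"
      unfolding cycles_def arrows_def by auto
    then have "as \<in> cycle_listings n \<alpha>" "C = set as"
      using components_subset[of C n \<alpha>] by (simp_all add: cycle_listings_def)
    then show "C \<in> set ` cycle_listings n \<alpha>" by blast
  qed
next
  have "set as \<in> components n \<alpha>" if "as \<in> cycle_listings n \<alpha>" for as
  proof (rule path_closed_in_components)
    note R = that[unfolded cycle_listings_iff]
    show "x \<in> set as \<longleftrightarrow> y \<in> set as" if "\<alpha> x = Some y" for x y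
    proof (rule path_closed_if_ends_closed[OF \<alpha> _ _ _ that])
      show "x \<in> set as" if "\<alpha> x = Some (hd as)" for x
        using IS_injD[OF \<alpha> that, of "last as"] R by simp
    qed (use R in auto)
  qed (use that[unfolded cycle_listings_iff] in auto)
  then show "set ` cycle_listings n \<alpha> \<subseteq> cycles n \<alpha>"
    by (auto simp: cycles_def cycle_listings_def arrows_def)
qed

section \<open>Cycle listings and the stable rank\<close>

text \<open>A listing visits the iterates of its first point until the first return.\<close>
lemma inj_on_hd_cycle_listings: "inj_on hd (cycle_listings n \<alpha>)"
proof -
  have nth_eq: "as ! i = bs ! i"
    if "as \<in> cycle_listings n \<alpha>" "bs \<in> cycle_listings n \<alpha>" "hd as = hd bs"
      "i < length as" "i < length bs" for as bs i
    using that(4,5)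
  proof (induction i)
    case 0
    then show ?case using that by (simp add: cycle_listings_iff hd_conv_nth)
  next
    case (Suc i)
    then have "\<alpha> (as ! i) = Some (as ! Suc i)" "\<alpha> (bs ! i) = Some (bs ! Suc i)"
      using that by (auto simp: cycle_listings_iff)
    then show ?case using Suc by simp
  qed
  have len: "length bs \<le> length as"
    if as: "as \<in> cycle_listings n \<alpha>" and bs: "bs \<in> cycle_listings n \<alpha>" and hd: "hd as = hd bs"
    for as bs
  proof (rule ccontr)
    assume "\<not> length bs \<le> length as"
    then have l: "length as < length bs" by simp
    have ne: "as \<noteq> []" "bs \<noteq> []" using as bs by (auto simp: cycle_listings_iff)
    let ?i = "length as - 1"
    have i: "?i < length as" "Suc ?i = length as" using ne by auto
    have "last as = bs ! ?i"
      using nth_eq[OF as bs hd i(1)] l ne by (simp add: last_conv_nth)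
    moreover have "\<alpha> (bs ! ?i) = Some (bs ! length as)"
      using bs l i unfolding cycle_listings_iff by metis
    ultimately have "bs ! length as = bs ! 0"
      using as hd ne by (simp add: cycle_listings_iff hd_conv_nth)
    then show False using bs l ne
      by (metis cycle_listings_iff length_0_conv length_greater_0_conv nth_eq_iff_index_eq)
  qed
  show ?thesis
  proof (rule inj_onI)
    fix as bs
    assume *: "as \<in> cycle_listings n \<alpha>" "bs \<in> cycle_listings n \<alpha>" "hd as = hd bs"
    then have "length as = length bs" using len by (metis le_antisym)
    then show "as = bs" using nth_eq[OF *] by (simp add: nth_equalityI)
  qed
qed

lemma rotate_cycle_listings:
  assumes as: "as \<in> cycle_listings n \<alpha>"
  shows "rotate k as \<in> cycle_listings n \<alpha>"
proof -
  have "\<alpha> (rotate k as ! i) = Some (rotate k as ! (Suc i mod length as))"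
    if i: "i < length as" for i
  proof -
    have "(k + i) mod length as < length as" using i by (intro mod_less_divisor) linarith
    then have "\<alpha> (as ! ((k + i) mod length as)) = Some (as ! (Suc ((k + i) mod length as) mod length as))"
      using as by (auto simp: cycle_listings_def)
    moreover have "Suc i mod length as < length as" using i by (intro mod_less_divisor) linarith
    ultimately show ?thesis using i by (simp add: nth_rotate mod_simps)
  qed
  then show ?thesis using as by (simp add: cycle_listings_def)
qed

lemma bij_betw_hd_cycle_listings:
  assumes \<alpha>: "\<alpha> \<in> IS n"
  shows "bij_betw hd (cycle_listings n \<alpha>) (\<Union> (cycles n \<alpha>))"
proof -
  have "x \<in> hd ` cycle_listings n \<alpha>" if as: "as \<in> cycle_listings n \<alpha>" and x: "x \<in> set as" for as x
  proof -
    from x obtain k where k: "k < length as" "x = as ! k" by (auto simp: in_set_conv_nth)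
    then have "hd (rotate k as) = x"
      by (metis hd_rotate_conv_nth list.size(3) mod_less not_less_zero)
    then show ?thesis using rotate_cycle_listings[OF as] by blast
  qed
  moreover have "hd as \<in> set as" if "as \<in> cycle_listings n \<alpha>" for as
    using that by (simp add: cycle_listings_iff)
  ultimately have "hd ` cycle_listings n \<alpha> = \<Union> (cycles n \<alpha>)"
    unfolding cycles_eq_image_cycle_listings[OF \<alpha>] by blast
  then show ?thesis using inj_on_hd_cycle_listings by (simp add: bij_betw_def)
qed

lemma finite_cycle_listings: "finite (cycle_listings n \<alpha>)"
proof (rule finite_imageD[OF _ inj_on_hd_cycle_listings])
  have "hd ` cycle_listings n \<alpha> \<subseteq> {1..n}" by (auto simp: cycle_listings_iff subset_iff)
  then show "finite (hd ` cycle_listings n \<alpha>)" by (rule finite_subset) simp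
qed

text \<open>
  The rank of the permutational part counts image points; since every point of a cycle has its
  successor and its predecessor on the same cycle, these are exactly the points on cycles.
\<close>
lemma stable_rank_eq_card_cycle_listings:
  assumes \<alpha>: "\<alpha> \<in> IS n"
  shows "stable_rank n \<alpha> = card (cycle_listings n \<alpha>)"
proof -
  have "ran (\<alpha> |` \<Union> (cycles n \<alpha>)) = \<Union> (cycles n \<alpha>)"
  proof
    show "ran (\<alpha> |` \<Union> (cycles n \<alpha>)) \<subseteq> \<Union> (cycles n \<alpha>)"
    proof
      fix y assume "y \<in> ran (\<alpha> |` \<Union> (cycles n \<alpha>))"
      then obtain x as where as: "as \<in> cycle_listings n \<alpha>" "x \<in> set as" and xy: "\<alpha> x = Some y"
        unfolding cycles_eq_image_cycle_listings[OF \<alpha>]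
        by (auto simp: ran_def restrict_map_def split: if_splits)
      from as obtain i where "i < length as" "x = as ! i" by (auto simp: in_set_conv_nth)
      with as xy have "y = as ! (Suc i mod length as)" by (auto simp: cycle_listings_def)
      moreover have "Suc i mod length as < length as"
        using \<open>i < length as\<close> by (intro mod_less_divisor) linarith
      ultimately have "y \<in> set as" by simp
      then show "y \<in> \<Union> (cycles n \<alpha>)"
        using as unfolding cycles_eq_image_cycle_listings[OF \<alpha>] by blast
    qed
  next
    show "\<Union> (cycles n \<alpha>) \<subseteq> ran (\<alpha> |` \<Union> (cycles n \<alpha>))"
    proof
      fix y assume "y \<in> \<Union> (cycles n \<alpha>)"
      then obtain as where as: "as \<in> cycle_listings n \<alpha>" "hd as = y"
        using bij_betw_imp_surj_on[OF bij_betw_hd_cycle_listings[OF \<alpha>]] by (metis imageE)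
      then have "\<alpha> (last as) = Some y" "last as \<in> set as"
        by (simp_all add: cycle_listings_iff)
      moreover from this have "last as \<in> \<Union> (cycles n \<alpha>)"
        using as unfolding cycles_eq_image_cycle_listings[OF \<alpha>] by blast
      ultimately show "y \<in> ran (\<alpha> |` \<Union> (cycles n \<alpha>))" by (auto simp: ran_def restrict_map_def)
    qed
  qed
  then show ?thesis
    using bij_betw_same_card[OF bij_betw_hd_cycle_listings[OF \<alpha>]]
    by (simp add: stable_rank_def rank_def permutational_part_def)
qed

section \<open>Closing chains and opening cycles\<close>

text \<open>
  Closing or opening changes the map only at the last point, which in a distinct list does not
  occur among the sources of the inner arrows.
\<close>
lemma path_upd_last:
  assumes "distinct as"
  shows "(\<forall>i. Suc i < length as \<longrightarrow> (\<alpha>(last as := z)) (as ! i) = Some (as ! Suc i)) \<longleftrightarrow>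
    (\<forall>i. Suc i < length as \<longrightarrow> \<alpha> (as ! i) = Some (as ! Suc i))"
proof -
  have "as ! i \<noteq> last as" if "Suc i < length as" for i
  proof -
    have "as \<noteq> []" using that by auto
    then show ?thesis using that assms by (simp add: last_conv_nth nth_eq_iff_index_eq)
  qed
  then show ?thesis by simp
qed

text \<open>
  The new arrow preserves injectivity because a chain begins at a point outside the range.
\<close>
lemma close_chain:
  assumes \<alpha>: "\<alpha> \<in> IS n" and as: "as \<in> chains n \<alpha>"
  shows "\<alpha>(last as \<mapsto> hd as) \<in> IS n" "as \<in> cycle_listings n (\<alpha>(last as \<mapsto> hd as))"
proof -
  note R = as[unfolded chains_iff[OF \<alpha>]]
  have "last as \<in> {1..n}" "hd as \<in> {1..n}" using R by (auto simp: subset_iff)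
  moreover have "inj_on (\<alpha>(last as \<mapsto> hd as)) (dom (\<alpha>(last as \<mapsto> hd as)))"
  proof (rule inj_onI)
    fix x y
    assume "x \<in> dom (\<alpha>(last as \<mapsto> hd as))" "y \<in> dom (\<alpha>(last as \<mapsto> hd as))"
      "(\<alpha>(last as \<mapsto> hd as)) x = (\<alpha>(last as \<mapsto> hd as)) y"
    then show "x = y" using R IS_injD[OF \<alpha>] by (auto simp: ran_def split: if_splits)
  qed
  ultimately show "\<alpha>(last as \<mapsto> hd as) \<in> IS n"
    using \<alpha> unfolding IS_def by (auto simp: ran_def split: if_splits)
  show "as \<in> cycle_listings n (\<alpha>(last as \<mapsto> hd as))"
    unfolding cycle_listings_iff using R path_upd_last[of as \<alpha>] by simp
qed

lemma open_cycle:
  assumes \<beta>: "\<beta> \<in> IS n" and as: "as \<in> cycle_listings n \<beta>"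
  shows "\<beta>(last as := None) \<in> IS n" "as \<in> chains n (\<beta>(last as := None))"
proof -
  note R = as[unfolded cycle_listings_iff]
  show IS: "\<beta>(last as := None) \<in> IS n"
    using \<beta> unfolding IS_def by (auto simp: ran_def inj_on_def split: if_splits)
  \<comment> \<open>By injectivity, the deleted arrow was the only one into the first point.\<close>
  have "hd as \<notin> ran (\<beta>(last as := None))"
    using R IS_injD[OF \<beta>, of _ "hd as" "last as"] by (auto simp: ran_def split: if_splits)
  then show "as \<in> chains n (\<beta>(last as := None))"
    unfolding chains_iff[OF IS] using R path_upd_last[of as \<beta>] by simp
qed

lemma bij_betw_close_chain:
  "bij_betw (\<lambda>(\<alpha>, as). (\<alpha>(last as \<mapsto> hd as), as))
     (SIGMA \<alpha>:IS n. chains n \<alpha>) (SIGMA \<beta>:IS n. cycle_listings n \<beta>)"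
proof (rule bij_betw_byWitness[where f' = "\<lambda>(\<beta>, as). (\<beta>(last as := None), as)"])
  show "\<forall>p\<in>SIGMA \<alpha>:IS n. chains n \<alpha>.
    (case case p of (\<alpha>, as) \<Rightarrow> (\<alpha>(last as \<mapsto> hd as), as) of (\<beta>, as) \<Rightarrow> (\<beta>(last as := None), as)) = p"
    by (auto simp: chains_iff fun_upd_idem)
  show "\<forall>p\<in>SIGMA \<beta>:IS n. cycle_listings n \<beta>.
    (case case p of (\<beta>, as) \<Rightarrow> (\<beta>(last as := None), as) of (\<alpha>, as) \<Rightarrow> (\<alpha>(last as \<mapsto> hd as), as)) = p"
    by (auto simp: cycle_listings_iff fun_upd_idem)
qed (auto intro: close_chain open_cycle)

theorem theorem1:
  fixes n :: nat
  assumes "n \<ge> 1"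
  shows "total_chains n = (\<Sum>\<alpha>\<in>IS n. stable_rank n \<alpha>)"
proof -
  have "total_chains n = card (SIGMA \<alpha>:IS n. chains n \<alpha>)"
    unfolding total_chains_def by (simp add: card_SigmaI finite_IS finite_chains)
  also have "\<dots> = card (SIGMA \<beta>:IS n. cycle_listings n \<beta>)"
    by (rule bij_betw_same_card[OF bij_betw_close_chain])
  also have "\<dots> = (\<Sum>\<beta>\<in>IS n. card (cycle_listings n \<beta>))"
    by (simp add: card_SigmaI finite_IS finite_cycle_listings)
  also have "\<dots> = (\<Sum>\<beta>\<in>IS n. stable_rank n \<beta>)"
    by (simp add: stable_rank_eq_card_cycle_listings)
  finally show ?thesis .
qed

end
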